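(* Let $n\ge 1$, let $\mu$ be an FUI probability measure on $\Omega=\{0,1\}^n$, and let $\mathcal{A},\mathcal{B},\mathcal{C}\subseteq\Omega$ be nonempty increasing events with $\mu(\mathcal{A})\neq 0$. If $$\mu(\mathcal{A}\cap\mathcal{B}\cap\mathcal{C})=\mu(\mathcal{A}\cap\mathcal{B})\,\mu(\mathcal{C})\quad\text{and}\quad \mu(\mathcal{A}\cap\mathcal{B}\cap\mathcal{C})=\mu(\mathcal{A}\cap\mathcal{C})\,\mu(\mathcal{B})$$ (that is, under $\mu$, $\mathcal{A}\cap\mathcal{B}$ is independent of $\mathcal{C}$, and $\mathcal{A}\cap\mathcal{C}$ is independent of $\mathcal{B}$), then $\mathcal{B}$ and $\mathcal{C}$ are independent under $\mu$, i.e. $$\mu(\mathcal{B}\cap\mathcal{C})=\mu(\mathcal{B})\,\mu(\mathcal{C}).$$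
   Context: $\Omega=\{0,1\}^n$ carries the coordinatewise partial order (equivalently, it is identified with the power set of $[n]=\{1,\ldots,n\}$ ordered by inclusion). An event $\mathcal{A}\subseteq\Omega$ is increasing if $x\in\mathcal{A}$ and $x\le y$ imply $y\in\mathcal{A}$. A Bernoulli random variable is a $\{0,1\}$-valued random variable (with arbitrary parameter; different Bernoullis need not be identically distributed). A probability measure $\mu$ on $\Omega$ is FUI ("finitely many underlying independents") if it is the law of a random vector $(X_1,\ldots,X_n)$ for which there exist a finite $m$, independent Bernoulli random variables $Y_1,\ldots,Y_m$, and increasing (i.e. coordinatewise nondecreasing) functions $f_1,\ldots,f_n:\{0,1\}^m\to\{0,1\}$ such that $X_i=f_i(Y_1,\ldots,Y_m)$ for every $i\in[n]$. *)

theory Defs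
  imports "HOL-Probability.Probability"
begin

text \<open>
  The cube \<open>{0,1}\<^sup>n\<close>, with 0 and 1 rendered as the booleans. Points are extensional, i.e. they
  agree outside \<open>{1..n}\<close>, so the library's pointwise order on \<open>nat \<Rightarrow> bool\<close> restricts to the
  coordinatewise order on the cube.
\<close>

definition cube :: "nat \<Rightarrow> (nat \<Rightarrow> bool) set" where
  "cube n = {1..n} \<rightarrow>\<^sub>E UNIV"

definition increasing_event :: "nat \<Rightarrow> (nat \<Rightarrow> bool) set \<Rightarrow> bool" where
  "increasing_event n A \<longleftrightarrow> A \<subseteq> cube n \<and> (\<forall>x\<in>A. \<forall>y\<in>cube n. x \<le> y \<longrightarrow> y \<in> A)"

text \<open>
  \<open>FUI\<close>: finitely many underlying independents. The random variables \<open>Y 1, \<dots>, Y m\<close> live on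
  an arbitrary probability space \<open>P\<close>. HOL cannot quantify over the type of its points inside
  a formula, so that type is a parameter; a theorem assuming \<open>FUI TYPE('w) n \<mu>\<close> with a free type
  variable \<open>'w\<close> covers every probability space. Boolean-valued random variables are exactly
  the Bernoulli variables, and \<open>indep_vars\<close> includes their measurability.
\<close>

definition FUI :: "'w itself \<Rightarrow> nat \<Rightarrow> (nat \<Rightarrow> bool) measure \<Rightarrow> bool" where
  "FUI W n \<mu> \<longleftrightarrow>
    (\<exists>(P :: 'w measure) (m :: nat) (Y :: nat \<Rightarrow> 'w \<Rightarrow> bool) (f :: nat \<Rightarrow> (nat \<Rightarrow> bool) \<Rightarrow> bool).
      prob_space P \<and>
      prob_space.indep_vars P (\<lambda>_. count_space UNIV) Y {1..m} \<and>
      (\<forall>i\<in>{1..n}. mono_on (cube m) (f i)) \<and>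
      \<mu> = distr P (count_space (cube n)) (\<lambda>\<omega>. \<lambda>i\<in>{1..n}. f i (\<lambda>j\<in>{1..m}. Y j \<omega>)))"

lemma finite_cube: "finite (cube n)"
  unfolding cube_def by (intro finite_PiE) auto

text \<open>The map in \<open>FUI\<close> is measurable, so \<open>distr\<close> there is a genuine law.\<close>

lemma measurable_FUI_map:
  fixes Y :: "nat \<Rightarrow> 'w \<Rightarrow> bool"
  assumes "prob_space P" "prob_space.indep_vars P (\<lambda>_. count_space UNIV) Y {1..m}"
  shows "(\<lambda>\<omega>. \<lambda>i\<in>{1..n}. f i (\<lambda>j\<in>{1..m}. Y j \<omega>)) \<in> measurable P (count_space (cube n))"
proof -
  interpret prob_space P by fact
  have Y: "Y j \<in> measurable P (count_space UNIV)" if "j \<in> {1..m}" for j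
    using assms(2) that unfolding indep_vars_def by auto
  have "(\<lambda>\<omega>. \<lambda>j\<in>{1..m}. Y j \<omega>) \<in> measurable P (count_space (cube m))"
  proof (subst measurable_count_space_eq2[OF finite_cube], intro conjI ballI)
    fix a assume a: "a \<in> cube m"
    have "(\<lambda>\<omega>. \<lambda>j\<in>{1..m}. Y j \<omega>) -` {a} \<inter> space P
        = {\<omega> \<in> space P. \<forall>j\<in>{1..m}. Y j \<omega> = a j}"
    proof -
      have "(\<lambda>j\<in>{1..m}. Y j \<omega>) = a \<longleftrightarrow> (\<forall>j\<in>{1..m}. Y j \<omega> = a j)" for \<omega>
      proof
        assume "\<forall>j\<in>{1..m}. Y j \<omega> = a j"
        then have "(\<lambda>j\<in>{1..m}. Y j \<omega>) = restrict a {1..m}"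
          by (intro restrict_ext) blast
        also have "\<dots> = a"
          using a unfolding cube_def by (rule PiE_restrict)
        finally show "(\<lambda>j\<in>{1..m}. Y j \<omega>) = a" .
      qed auto
      then show ?thesis by blast
    qed
    also have "\<dots> \<in> sets P"
    proof (rule sets.sets_Collect_finite_All)
      fix j assume "j \<in> {1..m}"
      from measurable_sets[OF Y[OF this], of "{a j}"]
      show "{\<omega> \<in> space P. Y j \<omega> = a j} \<in> sets P"
        by (simp add: vimage_def Int_def conj_commute)
    qed simp
    finally show "(\<lambda>\<omega>. \<lambda>j\<in>{1..m}. Y j \<omega>) -` {a} \<inter> space P \<in> sets P" .
  qed (auto simp: cube_def)
  moreover have "(\<lambda>y. \<lambda>i\<in>{1..n}. f i y) \<in> measurable (count_space (cube m)) (count_space (cube n))"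
    by (auto simp: cube_def)
  ultimately show ?thesis
    by (rule measurable_compose)
qed

lemma FUI_prob_space:
  fixes W :: "'w itself"
  assumes "FUI W n \<mu>"
  shows "prob_space \<mu>"
proof -
  from assms obtain P :: "'w measure" and m and Y :: "nat \<Rightarrow> 'w \<Rightarrow> bool" and f where
    P: "prob_space P" "prob_space.indep_vars P (\<lambda>_. count_space UNIV) Y {1..m}" and
    \<mu>: "\<mu> = distr P (count_space (cube n)) (\<lambda>\<omega>. \<lambda>i\<in>{1..n}. f i (\<lambda>j\<in>{1..m}. Y j \<omega>))"
    unfolding FUI_def by blast
  show ?thesis
    unfolding \<mu> by (rule prob_space.prob_space_distr[OF P(1) measurable_FUI_map[OF P]])
qed

lemma FUI_space_sets: "FUI W n \<mu> \<Longrightarrow> space \<mu> = cube n \<and> sets \<mu> = Pow (cube n)"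
  unfolding FUI_def by auto

end

theory Submission
  imports Defs
begin

text \<open>
  Pulling the events back along the monotone map \<open>(f\<^sub>1, \<dots>, f\<^sub>n)\<close>, and freezing the
  almost surely constant \<open>Y\<^sub>j\<close>, one may assume that the measure is a product of Bernoulli
  measures with parameters in the open interval from 0 to 1. Conditioning on one coordinate \<open>i\<close>
  splits a covariance into a mixture of two covariances in the other coordinates and \<open>p\<^sub>i (1 - p\<^sub>i)\<close>
  times the product of the influences of \<open>i\<close>. Hence increasing events are independent iff no
  coordinate is pivotal for both. So no coordinate pivotal for \<open>C\<close> is pivotal for \<open>A \<inter> B\<close>, and
  none pivotal for \<open>B\<close> is pivotal for \<open>A \<inter> C\<close>; by the latter the complement of the set of
  coordinates pivotal for \<open>B\<close> lies in \<open>A\<close>. If \<open>i\<close> were pivotal for both \<open>B\<close> and \<open>C\<close>, take \<open>x\<close> with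
  \<open>x \<notin> B\<close> and \<open>insert i x \<in> B\<close>, and add to \<open>x\<close> all coordinates not pivotal for \<open>B\<close>. Then
  \<open>insert i x \<in> A \<inter> B\<close>, so \<open>x \<in> A \<inter> B\<close> as \<open>i\<close> is not pivotal for \<open>A \<inter> B\<close>, a contradiction.
\<close>

subsection \<open>Expectations on the power set of a finite set\<close>

text \<open>Point mass of the product Bernoulli measure, with points of the cube on \<open>J\<close>
  encoded as subsets of \<open>J\<close>: raising coordinate \<open>i\<close> becomes
  \<open>insert i\<close>, and induction on \<open>J\<close> applies.\<close>

definition bernoulli_weight :: "('a \<Rightarrow> real) \<Rightarrow> 'a set \<Rightarrow> 'a set \<Rightarrow> real" where
  "bernoulli_weight p J x = (\<Prod>j\<in>J. if j \<in> x then p j else 1 - p j)"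

definition bernoulli_mean :: "('a \<Rightarrow> real) \<Rightarrow> 'a set \<Rightarrow> ('a set \<Rightarrow> real) \<Rightarrow> real" where
  "bernoulli_mean p J h = (\<Sum>x\<in>Pow J. bernoulli_weight p J x * h x)"

definition bernoulli_cov ::
    "('a \<Rightarrow> real) \<Rightarrow> 'a set \<Rightarrow> ('a set \<Rightarrow> real) \<Rightarrow> ('a set \<Rightarrow> real) \<Rightarrow> real" where
  "bernoulli_cov p J g h =
     bernoulli_mean p J (\<lambda>x. g x * h x) - bernoulli_mean p J g * bernoulli_mean p J h"

lemma bernoulli_mean_empty [simp]: "bernoulli_mean p {} h = h {}"
  by (simp add: bernoulli_mean_def bernoulli_weight_def)

lemma bernoulli_mean_cong:
  "(\<And>x. x \<subseteq> J \<Longrightarrow> g x = h x) \<Longrightarrow> bernoulli_mean p J g = bernoulli_mean p J h"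
  unfolding bernoulli_mean_def by (intro sum.cong) auto

lemma bernoulli_mean_diff:
  "bernoulli_mean p J (\<lambda>x. g x - h x) = bernoulli_mean p J g - bernoulli_mean p J h"
  unfolding bernoulli_mean_def by (simp add: right_diff_distrib sum_subtractf)

text \<open>Conditioning on coordinate \<open>i\<close>: the subsets of \<open>insert i J\<close>
  are those of \<open>J\<close>, with or without \<open>i\<close> added. This is the recursion
  behind the inductions on the index set.\<close>

lemma bernoulli_mean_insert:
  assumes "finite J" "i \<notin> J"
  shows "bernoulli_mean p (insert i J) h =
    p i * bernoulli_mean p J (\<lambda>x. h (insert i x)) + (1 - p i) * bernoulli_mean p J h"
proof -
  have inj: "inj_on (insert i) (Pow J)"
    using assms(2) by (auto simp: inj_on_def)
  have w1: "bernoulli_weight p (insert i J) (insert i x) = p i * bernoulli_weight p J x" for x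
    using assms unfolding bernoulli_weight_def by (auto intro!: prod.cong)
  have w0: "bernoulli_weight p (insert i J) x = (1 - p i) * bernoulli_weight p J x"
    if "x \<in> Pow J" for x
    using assms that unfolding bernoulli_weight_def by auto
  have "bernoulli_mean p (insert i J) h =
      (\<Sum>x\<in>Pow J. bernoulli_weight p (insert i J) x * h x) +
      (\<Sum>x\<in>insert i ` Pow J. bernoulli_weight p (insert i J) x * h x)"
    unfolding bernoulli_mean_def Pow_insert using assms by (intro sum.union_disjoint) auto
  also have "(\<Sum>x\<in>Pow J. bernoulli_weight p (insert i J) x * h x) =
      (1 - p i) * bernoulli_mean p J h"
    unfolding bernoulli_mean_def sum_distrib_left by (intro sum.cong) (simp_all add: w0)
  also have "(\<Sum>x\<in>insert i ` Pow J. bernoulli_weight p (insert i J) x * h x) =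
      p i * bernoulli_mean p J (\<lambda>x. h (insert i x))"
    unfolding bernoulli_mean_def sum_distrib_left sum.reindex[OF inj]
    by (intro sum.cong) (simp_all add: w1 mult.assoc)
  finally show ?thesis by simp
qed

lemma bernoulli_mean_nonneg:
  assumes "\<And>j. j \<in> J \<Longrightarrow> 0 \<le> p j \<and> p j \<le> 1" and "\<And>x. x \<subseteq> J \<Longrightarrow> 0 \<le> h x"
  shows "0 \<le> bernoulli_mean p J h"
  unfolding bernoulli_mean_def bernoulli_weight_def
  using assms by (intro sum_nonneg mult_nonneg_nonneg prod_nonneg) auto

lemma bernoulli_mean_pos:
  assumes "finite J" and "\<And>j. j \<in> J \<Longrightarrow> 0 < p j \<and> p j < 1" and "\<And>x. x \<subseteq> J \<Longrightarrow> 0 \<le> h x"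
    and "y \<subseteq> J" and "0 < h y"
  shows "0 < bernoulli_mean p J h"
proof -
  have pos: "0 < bernoulli_weight p J x" for x
    unfolding bernoulli_weight_def using assms(2) by (intro prod_pos) auto
  show ?thesis
    unfolding bernoulli_mean_def
    by (rule sum_pos2[of _ y]) (use assms pos less_imp_le[OF pos] in auto)
qed

text \<open>In the recursion over \<open>i\<close>, parameter 0 or 1 kills one of the two branches,
  so such a coordinate can be frozen. What remains meets the strict bounds of
  \<open>bernoulli_mean_pos\<close>.\<close>

lemma bernoulli_mean_nondegenerate:
  assumes "finite K" and "\<And>j. j \<in> K \<Longrightarrow> 0 \<le> p j \<and> p j \<le> 1"
  shows "bernoulli_mean p K h =
    bernoulli_mean p {j\<in>K. 0 < p j \<and> p j < 1} (\<lambda>x. h (x \<union> {j\<in>K. p j = 1}))"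
  using assms
proof (induction K arbitrary: h rule: finite_induct)
  case empty
  then show ?case by simp
next
  case (insert i K)
  define J where "J = {j\<in>K. 0 < p j \<and> p j < 1}"
  define D where "D = {j\<in>K. p j = 1}"
  have IH: "bernoulli_mean p K h = bernoulli_mean p J (\<lambda>x. h (x \<union> D))" for h
    unfolding J_def D_def using insert by auto
  have J: "finite J" "i \<notin> J"
    unfolding J_def using insert by auto
  note step = bernoulli_mean_insert[OF insert(1,2)]
  consider "p i = 0" | "p i = 1" | "0 < p i" "p i < 1"
    using insert.prems[of i] by fastforce
  then show ?case
  proof cases
    case 1
    then have "{j\<in>insert i K. 0 < p j \<and> p j < 1} = J" "{j\<in>insert i K. p j = 1} = D"
      by (auto simp: J_def D_def)
    with 1 show ?thesis by (simp add: step IH)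
  next
    case 2
    then have "{j\<in>insert i K. 0 < p j \<and> p j < 1} = J" "{j\<in>insert i K. p j = 1} = insert i D"
      by (auto simp: J_def D_def)
    with 2 show ?thesis by (simp add: step IH)
  next
    case 3
    then have "{j\<in>insert i K. 0 < p j \<and> p j < 1} = insert i J" "{j\<in>insert i K. p j = 1} = D"
      by (auto simp: J_def D_def)
    then show ?thesis by (simp add: step IH bernoulli_mean_insert[OF J])
  qed
qed

text \<open>Law of total covariance: the conditional means of \<open>g\<close> and \<open>h\<close>
  are affine in the indicator of coordinate \<open>i\<close>, with the influences as slopes, and
  this indicator has variance \<open>p i * (1 - p i)\<close>.\<close>

lemma bernoulli_cov_insert:
  assumes "finite J" "i \<notin> J"
  shows "bernoulli_cov p (insert i J) g h =
    p i * bernoulli_cov p J (\<lambda>x. g (insert i x)) (\<lambda>x. h (insert i x)) +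
    (1 - p i) * bernoulli_cov p J g h +
    p i * (1 - p i) * (bernoulli_mean p J (\<lambda>x. g (insert i x) - g x) *
      bernoulli_mean p J (\<lambda>x. h (insert i x) - h x))"
  unfolding bernoulli_cov_def bernoulli_mean_insert[OF assms] bernoulli_mean_diff
  by (simp add: algebra_simps)

text \<open>Induction on \<open>J\<close>: sections of monotone functions are monotone and
  influences are nonnegative, so all three terms of \<open>bernoulli_cov_insert\<close> are
  nonnegative.\<close>

lemma harris:
  assumes "finite J" and "\<And>j. j \<in> J \<Longrightarrow> 0 \<le> p j \<and> p j \<le> 1"
    and "mono_on (Pow J) g" and "mono_on (Pow J) h"
  shows "0 \<le> bernoulli_cov p J g h"
  using assms
proof (induction J arbitrary: g h rule: finite_induct)
  case empty
  then show ?case by (simp add: bernoulli_cov_def)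
next
  case (insert i J)
  have diff: "0 \<le> bernoulli_mean p J (\<lambda>x. u (insert i x) - u x)"
    if "mono_on (Pow (insert i J)) u" for u
    using insert.prems(1) by (intro bernoulli_mean_nonneg) (auto intro: mono_onD[OF that])
  have sections: "mono_on (Pow J) (\<lambda>x. u (insert i x))" "mono_on (Pow J) u"
    if "mono_on (Pow (insert i J)) u" for u
    by (auto intro!: mono_onI mono_onD[OF that])
  have "0 \<le> p i" "p i \<le> 1" using insert.prems(1) by auto
  moreover have "0 \<le> bernoulli_cov p J (\<lambda>x. g (insert i x)) (\<lambda>x. h (insert i x))"
    "0 \<le> bernoulli_cov p J g h"
    using insert.prems by (intro insert.IH sections; simp)+
  ultimately show ?case
    unfolding bernoulli_cov_insert[OF insert(1,2)]
    using diff[OF insert.prems(2)] diff[OF insert.prems(3)] by simp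
qed

subsection \<open>Pivotal coordinates\<close>

definition pivotal :: "'a set \<Rightarrow> 'a set set \<Rightarrow> 'a \<Rightarrow> bool" where
  "pivotal J E i \<longleftrightarrow> (\<exists>x. x \<subseteq> J \<and> i \<notin> x \<and> x \<notin> E \<and> insert i x \<in> E)"

text \<open>Only the trace of \<open>E\<close> on \<open>Pow J\<close> is constrained. So
  \<open>E\<close> may be a pull-back containing sets outside \<open>J\<close>, and the same
  \<open>E\<close> serves as its own lower section when \<open>J\<close> shrinks.\<close>

definition up_closed :: "'a set \<Rightarrow> 'a set set \<Rightarrow> bool" where
  "up_closed J E \<longleftrightarrow> (\<forall>x y. x \<in> E \<longrightarrow> x \<subseteq> y \<longrightarrow> y \<subseteq> J \<longrightarrow> y \<in> E)"

lemma up_closedD: "up_closed J E \<Longrightarrow> x \<in> E \<Longrightarrow> x \<subseteq> y \<Longrightarrow> y \<subseteq> J \<Longrightarrow> y \<in> E"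
  unfolding up_closed_def by blast

lemma up_closed_Int: "up_closed J E \<Longrightarrow> up_closed J F \<Longrightarrow> up_closed J (E \<inter> F)"
  unfolding up_closed_def by blast

lemma mono_on_indicator_up_closed:
  "up_closed J E \<Longrightarrow> mono_on (Pow J) (indicat_real E)"
  unfolding up_closed_def indicator_def by (intro mono_onI) auto

lemma mem_union_nonpivotal_iff:
  assumes "finite T" "T \<subseteq> J" "x \<subseteq> J" "up_closed J E" "\<And>j. j \<in> T \<Longrightarrow> \<not> pivotal J E j"
  shows "x \<union> T \<in> E \<longleftrightarrow> x \<in> E"
  using assms
proof (induction T rule: finite_induct)
  case empty
  then show ?case by simp
next
  case (insert j T)
  have IH: "x \<union> T \<in> E \<longleftrightarrow> x \<in> E" using insert by auto
  have sub: "x \<union> T \<subseteq> J" "insert j (x \<union> T) \<subseteq> J" using insert.prems by auto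
  have "insert j (x \<union> T) \<in> E \<longleftrightarrow> x \<union> T \<in> E"
  proof
    assume "insert j (x \<union> T) \<in> E"
    moreover have "\<not> pivotal J E j" using insert.prems by simp
    ultimately show "x \<union> T \<in> E"
      using sub(1) unfolding pivotal_def by (metis insert_absorb)
  qed (rule up_closedD[OF insert.prems(3) _ _ sub(2)], auto)
  with IH show ?case by simp
qed

text \<open>Split off \<open>i\<close>. The section covariances are nonnegative by
  \<open>harris\<close>; the product of influences is positive because each pivotal witness has
  positive weight.\<close>

lemma cov_pos_if_common_pivotal:
  assumes "finite J" and p: "\<And>j. j \<in> J \<Longrightarrow> 0 < p j \<and> p j < 1"
    and E: "up_closed J E" and F: "up_closed J F"
    and i: "i \<in> J" "pivotal J E i" "pivotal J F i"
  shows "0 < bernoulli_cov p J (indicator E) (indicator F)"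
proof -
  define K where "K = J - {i}"
  have K: "finite K" "i \<notin> K" "J = insert i K"
    using assms(1) i(1) by (auto simp: K_def)
  have pK: "\<And>j. j \<in> K \<Longrightarrow> 0 < p j \<and> p j < 1" and pi: "0 < p i" "p i < 1"
    using p K(3) by auto
  have influence: "0 < bernoulli_mean p K (\<lambda>x. indicat_real G (insert i x) - indicat_real G x)"
    if G: "up_closed J G" and "pivotal J G i" for G
  proof -
    obtain x where x: "x \<subseteq> J" "i \<notin> x" "x \<notin> G" "insert i x \<in> G"
      using \<open>pivotal J G i\<close> unfolding pivotal_def by blast
    show ?thesis
    proof (rule bernoulli_mean_pos[OF K(1) pK])
      show "0 \<le> indicat_real G (insert i y) - indicat_real G y" if "y \<subseteq> K" for y
        using up_closedD[OF G, of y "insert i y"] that K(3) by (auto simp: indicator_def)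
      show "x \<subseteq> K" using x K(3) by auto
      show "0 < indicat_real G (insert i x) - indicat_real G x" using x by simp
    qed
  qed
  have sections: "mono_on (Pow K) (\<lambda>x. indicat_real G (insert i x))"
    "mono_on (Pow K) (indicat_real G)" if "up_closed J G" for G
    using K(3) by (auto intro!: mono_onI mono_onD[OF mono_on_indicator_up_closed[OF that]])
  have "0 \<le> bernoulli_cov p K (\<lambda>x. indicator E (insert i x)) (\<lambda>x. indicator F (insert i x))"
    "0 \<le> bernoulli_cov p K (indicator E) (indicator F)"
    using pK by (intro harris[OF K(1)] sections E F; force)+
  with influence[OF E i(2)] influence[OF F i(3)] pi show ?thesis
    unfolding K(3) bernoulli_cov_insert[OF K(1,2)]
    by (intro add_nonneg_pos add_nonneg_nonneg mult_pos_pos mult_nonneg_nonneg) auto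
qed

text \<open>Induction on \<open>J\<close>: coordinates pivotal for a section are pivotal for the
  whole event, so both section covariances vanish, and one of the two influences of the removed
  coordinate is zero.\<close>

lemma cov_zero_if_no_common_pivotal:
  assumes "finite J" and "up_closed J E" and "up_closed J F"
    and "\<And>i. i \<in> J \<Longrightarrow> \<not> (pivotal J E i \<and> pivotal J F i)"
  shows "bernoulli_cov p J (indicator E) (indicator F) = 0"
  using assms
proof (induction J arbitrary: E F rule: finite_induct)
  case empty
  then show ?case by (simp add: bernoulli_cov_def)
next
  case (insert i J)
  have up: "up_closed J (insert i -` G)" "up_closed J G" if "up_closed (insert i J) G" for G
  proof -
    show "up_closed J (insert i -` G)"
      unfolding up_closed_def by (auto elim!: up_closedD[OF that])
    show "up_closed J G"
      unfolding up_closed_def by (auto elim!: up_closedD[OF that])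
  qed
  have piv: "pivotal J (insert i -` G) j \<Longrightarrow> pivotal (insert i J) G j"
    "pivotal J G j \<Longrightarrow> pivotal (insert i J) G j" if "j \<in> J" for G j
  proof -
    assume "pivotal J (insert i -` G) j"
    then obtain x where "x \<subseteq> J" "j \<notin> x" "insert i x \<notin> G" "insert i (insert j x) \<in> G"
      unfolding pivotal_def by auto
    moreover have "j \<noteq> i" using that insert(2) by auto
    ultimately show "pivotal (insert i J) G j"
      unfolding pivotal_def by (intro exI[of _ "insert i x"]) (auto simp: insert_commute)
  next
    show "pivotal J G j \<Longrightarrow> pivotal (insert i J) G j"
      unfolding pivotal_def by blast
  qed
  have ind: "(\<lambda>x. indicat_real G (insert i x)) = indicator (insert i -` G)" for G
    by (auto simp: indicator_def)
  have cov: "bernoulli_cov p J (\<lambda>x. indicator E (insert i x)) (\<lambda>x. indicator F (insert i x)) = 0"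
    "bernoulli_cov p J (indicator E) (indicator F) = 0"
    unfolding ind using insert.prems(3) piv by (intro insert.IH up insert.prems(1,2); blast)+
  have influence: "bernoulli_mean p J (\<lambda>x. indicat_real G (insert i x) - indicat_real G x) = 0"
    if G: "up_closed (insert i J) G" and "\<not> pivotal (insert i J) G i" for G
  proof -
    have "indicat_real G (insert i x) - indicat_real G x = 0" if x: "x \<subseteq> J" for x
    proof -
      have "x \<in> G \<longleftrightarrow> insert i x \<in> G"
        using \<open>\<not> pivotal (insert i J) G i\<close> up_closedD[OF G, of x "insert i x"] x insert(2)
        unfolding pivotal_def by blast
      then show ?thesis by (simp add: indicator_def)
    qed
    then have "bernoulli_mean p J (\<lambda>x. indicat_real G (insert i x) - indicat_real G x) =
        bernoulli_mean p J (\<lambda>x. 0)"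
      by (intro bernoulli_mean_cong)
    then show ?thesis by (simp add: bernoulli_mean_def)
  qed
  have "\<not> pivotal (insert i J) E i \<or> \<not> pivotal (insert i J) F i"
    using insert.prems(3)[of i] by blast
  then show ?case
    unfolding bernoulli_cov_insert[OF insert(1,2)] cov
    using influence insert.prems(1,2) by auto
qed

section \<open>Three increasing events: from pivotal coordinates to independence\<close>

lemma no_common_pivotal:
  assumes fin: "finite J"
    and up: "up_closed J A" "up_closed J B" "up_closed J C"
    and top: "J \<in> A" "J \<in> C"
    and AB: "\<And>i. i \<in> J \<Longrightarrow> \<not> (pivotal J (A \<inter> B) i \<and> pivotal J C i)"
    and AC: "\<And>i. i \<in> J \<Longrightarrow> \<not> (pivotal J (A \<inter> C) i \<and> pivotal J B i)"
    and i: "i \<in> J"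
  shows "\<not> (pivotal J B i \<and> pivotal J C i)"
proof
  assume piv: "pivotal J B i \<and> pivotal J C i"
  define V where "V = {j\<in>J. pivotal J B j}"
  have V: "finite V" "V \<subseteq> J" "J - V \<union> V = J"
    using fin by (auto simp: V_def)
  \<comment> \<open>By \<open>AC\<close> no coordinate in \<open>V\<close> is pivotal for
    \<open>A \<inter> C\<close>, so all of \<open>V\<close> can be removed from the top point
    \<open>J\<close> without leaving \<open>A \<inter> C\<close>.\<close>
  have "J - V \<union> V \<in> A \<inter> C \<longleftrightarrow> J - V \<in> A \<inter> C"
    by (rule mem_union_nonpivotal_iff[OF V(1,2)]) (use up AC in \<open>auto simp: V_def intro: up_closed_Int\<close>)
  then have JV: "J - V \<in> A"
    using top V(3) by auto
  obtain x where x: "x \<subseteq> J" "i \<notin> x" "x \<notin> B" "insert i x \<in> B"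
    using piv unfolding pivotal_def by blast
  \<comment> \<open>Enlarging \<open>x\<close> by \<open>J - V\<close> forces
    \<open>insert i y\<close> into \<open>A\<close>, yet keeps \<open>y\<close> outside
    \<open>B\<close>, since the added coordinates are not pivotal for \<open>B\<close>. As
    \<open>i\<close> lies in \<open>V\<close>, it is not added.\<close>
  define y where "y = x \<union> (J - V)"
  have y: "y \<subseteq> J" "insert i y \<subseteq> J" "i \<notin> y"
    using x i piv by (auto simp: y_def V_def)
  have "y \<notin> B"
    unfolding y_def using x fin up(2)
    by (subst mem_union_nonpivotal_iff[where J = J]) (auto simp: V_def)
  moreover have "insert i y \<in> B"
    by (rule up_closedD[OF up(2) x(4) _ y(2)]) (auto simp: y_def)
  moreover have "insert i y \<in> A"
    by (rule up_closedD[OF up(1) JV _ y(2)]) (auto simp: y_def)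
  ultimately have "pivotal J (A \<inter> B) i"
    unfolding pivotal_def using y by blast
  with AB[OF i] piv show False by blast
qed

lemma independent_of_intersections_independent:
  assumes fin: "finite J" and p: "\<And>j. j \<in> J \<Longrightarrow> 0 < p j \<and> p j < 1"
    and up: "up_closed J A" "up_closed J B" "up_closed J C"
    and top: "J \<in> A" "J \<in> C"
    and "bernoulli_cov p J (indicator (A \<inter> B)) (indicator C) = 0"
    and "bernoulli_cov p J (indicator (A \<inter> C)) (indicator B) = 0"
  shows "bernoulli_cov p J (indicator B) (indicator C) = 0"
proof (rule cov_zero_if_no_common_pivotal[OF fin up(2,3)])
  have "\<not> (pivotal J (A \<inter> B) i \<and> pivotal J C i)" if "i \<in> J" for i
    using cov_pos_if_common_pivotal[OF fin _ up_closed_Int[OF up(1,2)] up(3) that] p assms(8) by force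
  moreover have "\<not> (pivotal J (A \<inter> C) i \<and> pivotal J B i)" if "i \<in> J" for i
    using cov_pos_if_common_pivotal[OF fin _ up_closed_Int[OF up(1,3)] up(2) that] p assms(9) by force
  ultimately show "\<not> (pivotal J B i \<and> pivotal J C i)" if "i \<in> J" for i
    using no_common_pivotal[OF fin up top] that by blast
qed

subsection \<open>Laws of increasing functions of independent Bernoulli variables\<close>

text \<open>The sample space is partitioned into cells according to the set of \<open>j\<close> with
  \<open>Y j\<close> true; independence makes the probability of each cell a product.\<close>

lemma (in prob_space) prob_indep_bernoulli:
  fixes Y :: "nat \<Rightarrow> 'a \<Rightarrow> bool" and K :: "nat set"
  assumes indep: "indep_vars (\<lambda>_. count_space UNIV) Y K" and fin: "finite K"
  shows "prob {\<omega>\<in>space M. S {j\<in>K. Y j \<omega>}} =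
    bernoulli_mean (\<lambda>j. prob {\<omega>\<in>space M. Y j \<omega>}) K (\<lambda>x. of_bool (S x))"
proof -
  have rv: "Y j \<in> measurable M (count_space UNIV)" if "j \<in> K" for j
    using indep that unfolding indep_vars_def by auto
  have ev: "{\<omega>\<in>space M. Y j \<omega> = b} \<in> events" if "j \<in> K" for j b
    using measurable_sets[OF rv[OF that], of "{b}"]
    by (simp add: vimage_def Int_def conj_commute)
  define cell where "cell x = {\<omega>\<in>space M. \<forall>j\<in>K. Y j \<omega> = (j \<in> x)}" for x
  have cell_ev: "cell x \<in> events" for x
    unfolding cell_def using fin ev by (intro sets.sets_Collect_finite_All) auto
  have cell_prob: "prob (cell x) = bernoulli_weight (\<lambda>j. prob {\<omega>\<in>space M. Y j \<omega>}) K x" for x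
  \<comment> \<open>\<open>indep_varsD\<close> needs a nonempty index set. For empty
    \<open>K\<close> the cell is the whole space and the product is 1.\<close>
  proof (cases "K = {}")
    case True
    then show ?thesis by (simp add: cell_def bernoulli_weight_def prob_space)
  next
    case False
    have "prob (cell x) = prob (\<Inter>j\<in>K. Y j -` {j \<in> x} \<inter> space M)"
      using False by (intro arg_cong[where f = prob]) (auto simp: cell_def)
    also have "\<dots> = (\<Prod>j\<in>K. prob (Y j -` {j \<in> x} \<inter> space M))"
      using indep_varsD[OF indep False fin, of "\<lambda>j. {j \<in> x}"] by simp
    also have "\<dots> = bernoulli_weight (\<lambda>j. prob {\<omega>\<in>space M. Y j \<omega>}) K x"
      unfolding bernoulli_weight_def
    proof (rule prod.cong[OF refl])
      fix j assume j: "j \<in> K"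
      have *: "Y j -` {j \<in> x} \<inter> space M = (if j \<in> x then {\<omega>\<in>space M. Y j \<omega>}
          else space M - {\<omega>\<in>space M. Y j \<omega>})"
        by auto
      show "prob (Y j -` {j \<in> x} \<inter> space M) = (if j \<in> x then prob {\<omega>\<in>space M. Y j \<omega>}
          else 1 - prob {\<omega>\<in>space M. Y j \<omega>})"
        unfolding * using ev[OF j, of True] by (simp add: prob_compl)
    qed
    finally show ?thesis .
  qed
  have "{\<omega>\<in>space M. S {j\<in>K. Y j \<omega>}} = (\<Union>x\<in>{x\<in>Pow K. S x}. cell x)"
  proof -
    have "\<omega> \<in> cell x \<longleftrightarrow> \<omega> \<in> space M \<and> {j\<in>K. Y j \<omega>} = x" if "x \<subseteq> K" for \<omega> x
      using that by (auto simp: cell_def)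
    then show ?thesis by auto
  qed
  also have "prob \<dots> = (\<Sum>x\<in>{x\<in>Pow K. S x}. prob (cell x))"
    by (rule finite_measure_finite_Union)
      (use fin cell_ev in \<open>auto simp: cell_def disjoint_family_on_def\<close>)
  also have "\<dots> = bernoulli_mean (\<lambda>j. prob {\<omega>\<in>space M. Y j \<omega>}) K (\<lambda>x. of_bool (S x))"
    unfolding bernoulli_mean_def using fin
    by (intro sum.mono_neutral_cong_left) (auto simp: cell_prob)
  finally show ?thesis .
qed

text \<open>Represents \<open>\<mu>\<close> as the image of a nondegenerate product measure under
  the monotone map \<open>F\<close>, in which the coordinates that are almost surely true are built
  in as the set \<open>D\<close>.\<close>

lemma FUI_eq_bernoulli_mean:
  fixes W :: "'w itself"
  assumes "FUI W n \<mu>"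
  obtains J :: "nat set" and p and F where
    "finite J" "\<And>j. j \<in> J \<Longrightarrow> 0 < p j \<and> p j < 1"
    "\<And>x. F x \<in> cube n" "\<And>x y. x \<subseteq> y \<Longrightarrow> F x \<le> F y"
    "\<And>S. S \<subseteq> cube n \<Longrightarrow> measure \<mu> S = bernoulli_mean p J (indicator (F -` S))"
proof -
  from assms obtain P :: "'w measure" and m and Y :: "nat \<Rightarrow> 'w \<Rightarrow> bool" and f where
    P: "prob_space P" "prob_space.indep_vars P (\<lambda>_. count_space UNIV) Y {1..m}" and
    f: "\<forall>i\<in>{1..n}. mono_on (cube m) (f i)" and
    \<mu>: "\<mu> = distr P (count_space (cube n)) (\<lambda>\<omega>. \<lambda>i\<in>{1..n}. f i (\<lambda>j\<in>{1..m}. Y j \<omega>))"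
    unfolding FUI_def by blast
  interpret prob_space P by fact
  define p where "p j = prob {\<omega>\<in>space P. Y j \<omega>}" for j
  define J where "J = {j\<in>{1..m}. 0 < p j \<and> p j < 1}"
  define D where "D = {j\<in>{1..m}. p j = 1}"
  define G where "G x = (\<lambda>i\<in>{1..n}. f i (\<lambda>j\<in>{1..m}. j \<in> x))" for x :: "nat set"
  have G_mono: "G x \<le> G y" if "x \<subseteq> y" for x y
  proof (rule le_funI)
    fix i
    have "f i (\<lambda>j\<in>{1..m}. j \<in> x) \<le> f i (\<lambda>j\<in>{1..m}. j \<in> y)" if "i \<in> {1..n}"
      using f that \<open>x \<subseteq> y\<close>
      by (intro mono_onD[of "cube m" "f i"]) (auto simp: cube_def le_fun_def)
    then show "G x i \<le> G y i" by (auto simp: G_def)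
  qed
  have G_cube: "G x \<in> cube n" for x
    by (simp add: G_def cube_def)
  have law: "measure \<mu> S = bernoulli_mean p J (indicator ((\<lambda>x. G (x \<union> D)) -` S))"
    if "S \<subseteq> cube n" for S
  proof -
    have G: "(\<lambda>i\<in>{1..n}. f i (\<lambda>j\<in>{1..m}. Y j \<omega>)) = G {j\<in>{1..m}. Y j \<omega>}" for \<omega>
      unfolding G_def by (intro restrict_ext arg_cong[where f = "f _"]) auto
    have "measure \<mu> S = prob ((\<lambda>\<omega>. \<lambda>i\<in>{1..n}. f i (\<lambda>j\<in>{1..m}. Y j \<omega>)) -` S \<inter> space P)"
      unfolding \<mu> using that by (intro measure_distr measurable_FUI_map[OF P]) auto
    also have "\<dots> = prob {\<omega>\<in>space P. G {j\<in>{1..m}. Y j \<omega>} \<in> S}"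
      unfolding G by (intro arg_cong[where f = prob]) auto
    also have "\<dots> = bernoulli_mean p {1..m} (\<lambda>x. of_bool (G x \<in> S))"
      unfolding p_def by (rule prob_indep_bernoulli[OF P(2)]) simp
    also have "\<dots> = bernoulli_mean p J (\<lambda>x. of_bool (G (x \<union> D) \<in> S))"
      unfolding J_def D_def by (rule bernoulli_mean_nondegenerate) (auto simp: p_def)
    also have "\<dots> = bernoulli_mean p J (indicator ((\<lambda>x. G (x \<union> D)) -` S))"
      by (intro bernoulli_mean_cong) (simp add: indicator_def)
    finally show ?thesis .
  qed
  show thesis
    by (rule that[of J p "\<lambda>x. G (x \<union> D)"])
      (use law in \<open>auto simp: J_def G_cube intro!: G_mono\<close>)
qed

theorem theorem2:
  fixes n :: nat
    and \<mu> :: "(nat \<Rightarrow> bool) measure"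
    and A B C :: "(nat \<Rightarrow> bool) set"
  assumes "n \<ge> 1"
    and "FUI TYPE('w) n \<mu>"
    and "increasing_event n A" and "increasing_event n B" and "increasing_event n C"
    and "A \<noteq> {}" and "B \<noteq> {}" and "C \<noteq> {}"
    and "measure \<mu> A \<noteq> 0"
    and "measure \<mu> (A \<inter> B \<inter> C) = measure \<mu> (A \<inter> B) * measure \<mu> C"
    and "measure \<mu> (A \<inter> B \<inter> C) = measure \<mu> (A \<inter> C) * measure \<mu> B"
  shows "measure \<mu> (B \<inter> C) = measure \<mu> B * measure \<mu> C"
proof -
  from FUI_eq_bernoulli_mean[OF assms(2)] obtain J :: "nat set" and p F where
    fin: "finite J" and p: "\<And>j. j \<in> J \<Longrightarrow> 0 < p j \<and> p j < 1" and
    F: "\<And>x. F x \<in> cube n" "\<And>x y. x \<subseteq> y \<Longrightarrow> F x \<le> F y" and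
    law: "\<And>S. S \<subseteq> cube n \<Longrightarrow> measure \<mu> S = bernoulli_mean p J (indicator (F -` S))"
    by metis
  have up: "up_closed J (F -` S)" if "increasing_event n S" for S
    unfolding up_closed_def
  proof (intro allI impI)
    fix x y assume "x \<in> F -` S" "x \<subseteq> y"
    moreover have "F x \<le> F y" by (rule F(2)) fact
    ultimately show "y \<in> F -` S"
      using that F(1)[of y] unfolding increasing_event_def by auto
  qed
  have sub: "A \<subseteq> cube n" "B \<subseteq> cube n" "C \<subseteq> cube n"
    using assms(3-5) by (auto simp: increasing_event_def)
  \<comment> \<open>The covariance of the pull-backs measures the failure of independence under
    \<open>\<mu>\<close>, so both hypotheses become vanishing covariances.\<close>
  have cov: "bernoulli_cov p J (indicator (F -` S)) (indicator (F -` T)) =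
      measure \<mu> (S \<inter> T) - measure \<mu> S * measure \<mu> T"
    if "S \<subseteq> cube n" "T \<subseteq> cube n" for S T
  proof -
    have "measure \<mu> (S \<inter> T) =
        bernoulli_mean p J (\<lambda>x. indicator (F -` S) x * indicator (F -` T) x)"
      using that by (subst law) (auto simp: indicator_def intro!: bernoulli_mean_cong)
    then show ?thesis using that by (simp add: bernoulli_cov_def law)
  qed
  \<comment> \<open>An up-closed pull-back that misses the top point \<open>J\<close> misses every
    subset of \<open>J\<close>.\<close>
  have null: "measure \<mu> S = 0" if "increasing_event n S" "J \<notin> F -` S" for S
  proof -
    have "x \<notin> F -` S" if "x \<subseteq> J" for x
      using up_closedD[OF up[OF \<open>increasing_event n S\<close>], of x J] that \<open>J \<notin> F -` S\<close> by blast
    then have "bernoulli_mean p J (indicator (F -` S)) = bernoulli_mean p J (\<lambda>_. 0)"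
      by (intro bernoulli_mean_cong) simp
    then show ?thesis
      using that(1) by (simp add: law increasing_event_def bernoulli_mean_def)
  qed
  have JA: "J \<in> F -` A" using null[OF assms(3)] assms(9) by blast
  show ?thesis
  \<comment> \<open>Nonemptiness of \<open>C\<close> does not put \<open>J\<close> into its
    pull-back. If \<open>J\<close> is missing, \<open>C\<close> and \<open>B \<inter> C\<close> are
    null and both sides are 0.\<close>
  proof (cases "J \<in> F -` C")
    case True
    have "bernoulli_cov p J (indicator (F -` A \<inter> F -` B)) (indicator (F -` C)) = 0"
      using cov[of "A \<inter> B" C] sub assms(10) by (simp add: vimage_Int le_infI1)
    moreover have "bernoulli_cov p J (indicator (F -` A \<inter> F -` C)) (indicator (F -` B)) = 0"
      using cov[of "A \<inter> C" B] sub assms(11) by (simp add: vimage_Int le_infI1 Int_ac)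
    ultimately have "bernoulli_cov p J (indicator (F -` B)) (indicator (F -` C)) = 0"
      using independent_of_intersections_independent[where p = p, OF fin p
          up[OF assms(3)] up[OF assms(4)] up[OF assms(5)] JA True] by blast
    then show ?thesis using cov[OF sub(2,3)] by simp
  next
    case False
    have "increasing_event n (B \<inter> C)"
      using assms(4,5) by (auto simp: increasing_event_def)
    then show ?thesis
      using null[OF assms(5) False] null[of "B \<inter> C"] False by simp
  qed
qed

end
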